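(* Let $\{R,S,B\}$ be a configurable triple with ground space $H$, and let $V$ be configurated by the triple $\{R,S,B\}$. Let $Y=BR+S$ with inner product $c(\cdot,\cdot)$, and let $a_R$, $a_S$, $b$ be the bilinear forms described in the context, such that $$a(u,v):=a_R(u,v)+b(u,Bv)+b(v,Bu)+a_S(Bu,Bv)$$ is coercive on $V$. Given $f_R\in R'$ and $f_S\in S'$, the problem: find $(u,\phi,\zeta)\in X:=R\times S\times Y$ such that for all $(v,\psi,\eta)\in X$ $$ \left\{ \begin{array}{l} a_R(u,v)+b(v,\phi)+c(Bv,\zeta)=\langle f_R,v\rangle,\\ b(u,\psi)+a_S(\phi,\psi)-c(\psi,\zeta)=\langle f_S,\psi\rangle,\\ c(Bu,\eta)-c(\phi,\eta)=0, \end{array} \right. $$ admits a unique solution $(u,\phi,\zeta)\in X$, and there are constants $C_1,C_2>0$ independent of $f_R,f_S$ such that $$C_1\left(\|f_R\|_{R'}+\|f_S\|_{S'}\right)\le \|u\|_{R}+\|\phi\|_{S}+\|\zeta\|_{Y}\le C_2\left(\|f_R\|_{R'}+\|f_S\|_{S'}\right).$$ Moreover, $u$ solves the primal problem: $u\in V$ and $$a_R(u,v)+b(u,Bv)+b(v,Bu)+a_S(Bu,Bv)=\langle f_R,v\rangle+\langle f_S,Bv\rangle,\quad \forall\, v\in V.$$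
   Context: A prime denotes the dual space and $\langle\cdot,\cdot\rangle$ the duality pairing. Configurable triple: given Hilbert spaces $R$, $S$ and an operator $B$, the triple $\{R,S,B\}$ is called configurable with respect to a Hilbert space $H$ (called its ground space) if $S\subset H$ continuously and $B$ is a closed (linear) operator that maps $R$ into $H$. A Hilbert space $V$ with norm $\|\cdot\|_V$ is said to be configurated by $\{R,S,B\}$ if $V=\{w\in R: Bw\in S\}$ and $\|w\|_V$ is equivalent to $\|w\|_R+\|Bw\|_S$. Write $BR:=\{Br:r\in R\}\subset H$ and $Y:=BR+S=\{Br+s:r\in R,\ s\in S\}\subset H$, equipped with the norm $$\|y\|_Y:=\inf_{r\in R,\ s\in S,\ y=Br+s}\big(\|Br\|_H+\|s\|_S\big).$$ $c(\cdot,\cdot)$ is an inner product on $Y$, with induced norm equivalent to $\|\cdot\|_Y$. $a_R(\cdot,\cdot)$ and $a_S(\cdot,\cdot)$ are bounded symmetric semidefinite bilinear forms on $R$ and on $S$ respectively (not necessarily inner products), and $b(\cdot,\cdot)$ is a bounded bilinear form on $R\times S$. Coercivity of $a$ on $V$ means $a(v,v)\ge \gamma\|v\|_V^2$ for all $v\in V$, with some $\gamma>0$.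
   Formalization: The space Y is additionally assumed complete in its norm; without this the claim fails (e.g. R=H=ℓ², S={0}, B e_n=e_n/n, zero forms), and completeness of Y is necessary for the conclusion. *)

theory Defs
  imports "HOL-Analysis.Analysis"
begin

text \<open>
  The Hilbert spaces R, S and the ground space H are types of class real_inner and complete_space.
  The continuous inclusion of S in H is an injective bounded linear map \<open>J\<close>, since S carries
  its own inner product. The spaces V (inside R) and Y (inside H) are sets; a norm on such a set is
  a real-valued function that is only meaningful on the set.
\<close>

definition configurable ::
  "('r::{real_inner,complete_space} \<Rightarrow> 'h::{real_inner,complete_space})
   \<Rightarrow> ('s::{real_inner,complete_space} \<Rightarrow> 'h) \<Rightarrow> bool" where
  "configurable B J \<longleftrightarrow>
     bounded_linear J \<and> inj J \<and>
     linear B \<and> closed {(r, h). h = B r}"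

definition inner_product_on :: "'a::real_vector set \<Rightarrow> ('a \<Rightarrow> 'a \<Rightarrow> real) \<Rightarrow> bool" where
  "inner_product_on W ip \<longleftrightarrow>
     subspace W \<and>
     (\<forall>x\<in>W. \<forall>y\<in>W. ip x y = ip y x) \<and>
     (\<forall>x\<in>W. \<forall>y\<in>W. \<forall>z\<in>W. ip (x + y) z = ip x z + ip y z) \<and>
     (\<forall>k. \<forall>x\<in>W. \<forall>y\<in>W. ip (k *\<^sub>R x) y = k * ip x y) \<and>
     (\<forall>x\<in>W. x \<noteq> 0 \<longrightarrow> 0 < ip x x)"

definition ip_norm :: "('a \<Rightarrow> 'a \<Rightarrow> real) \<Rightarrow> 'a \<Rightarrow> real" where
  "ip_norm ip x = sqrt (ip x x)"

definition complete_in_norm :: "'a::real_vector set \<Rightarrow> ('a \<Rightarrow> real) \<Rightarrow> bool" where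
  "complete_in_norm W N \<longleftrightarrow>
     (\<forall>x :: nat \<Rightarrow> 'a. (\<forall>n. x n \<in> W) \<longrightarrow>
        (\<forall>e>0. \<exists>M. \<forall>m\<ge>M. \<forall>n\<ge>M. N (x m - x n) < e) \<longrightarrow>
        (\<exists>l\<in>W. (\<lambda>n. N (x n - l)) \<longlonglongrightarrow> 0))"

definition hilbert_space_on :: "'a::real_vector set \<Rightarrow> ('a \<Rightarrow> 'a \<Rightarrow> real) \<Rightarrow> bool" where
  "hilbert_space_on W ip \<longleftrightarrow> inner_product_on W ip \<and> complete_in_norm W (ip_norm ip)"

definition norm_equiv_on :: "'a set \<Rightarrow> ('a \<Rightarrow> real) \<Rightarrow> ('a \<Rightarrow> real) \<Rightarrow> bool" where
  "norm_equiv_on W N1 N2 \<longleftrightarrow>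
     (\<exists>k>0. \<exists>K>0. \<forall>x\<in>W. k * N2 x \<le> N1 x \<and> N1 x \<le> K * N2 x)"

text \<open>\<open>lift_S B J w\<close> is \<open>B w\<close> regarded as an element of S; it is only meaningful if
  \<open>B w \<in> range J\<close>.\<close>

definition lift_S :: "('r \<Rightarrow> 'h) \<Rightarrow> ('s \<Rightarrow> 'h) \<Rightarrow> 'r \<Rightarrow> 's" where
  "lift_S B J w = inv J (B w)"

definition configurated_by ::
  "'r::{real_inner,complete_space} set \<Rightarrow> ('r \<Rightarrow> 'r \<Rightarrow> real)
   \<Rightarrow> ('r \<Rightarrow> 'h::{real_inner,complete_space}) \<Rightarrow> ('s::{real_inner,complete_space} \<Rightarrow> 'h)
   \<Rightarrow> bool" where
  "configurated_by V ipV B J \<longleftrightarrow>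
     hilbert_space_on V ipV \<and>
     V = {w. B w \<in> range J} \<and>
     norm_equiv_on V (ip_norm ipV) (\<lambda>w. norm w + norm (lift_S B J w))"

definition Y_space :: "('r \<Rightarrow> 'h::real_normed_vector) \<Rightarrow> ('s \<Rightarrow> 'h) \<Rightarrow> 'h set" where
  "Y_space B J = {B r + J s |r s. True}"

text \<open>Since the norm below measures \<open>B r\<close> in H and not \<open>r\<close> in R, the space Y need not be complete when
  the range of \<open>B\<close> is not closed; that Y is a Hilbert space has to be required separately.\<close>

definition Y_norm ::
  "('r \<Rightarrow> 'h::real_normed_vector) \<Rightarrow> ('s::real_normed_vector \<Rightarrow> 'h) \<Rightarrow> 'h \<Rightarrow> real" where
  "Y_norm B J y = Inf {norm (B r) + norm s |r s. y = B r + J s}"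

definition symmetric_form :: "('a \<Rightarrow> 'a \<Rightarrow> real) \<Rightarrow> bool" where
  "symmetric_form a \<longleftrightarrow> (\<forall>x y. a x y = a y x)"

definition semidefinite_form :: "('a \<Rightarrow> 'a \<Rightarrow> real) \<Rightarrow> bool" where
  "semidefinite_form a \<longleftrightarrow> (\<forall>x. 0 \<le> a x x)"

definition primal_form ::
  "('r \<Rightarrow> 'h) \<Rightarrow> ('s \<Rightarrow> 'h) \<Rightarrow> ('r \<Rightarrow> 'r \<Rightarrow> real) \<Rightarrow> ('s \<Rightarrow> 's \<Rightarrow> real) \<Rightarrow> ('r \<Rightarrow> 's \<Rightarrow> real)
   \<Rightarrow> 'r \<Rightarrow> 'r \<Rightarrow> real" where
  "primal_form B J aR aS b u v =
     aR u v + b u (lift_S B J v) + b v (lift_S B J u) + aS (lift_S B J u) (lift_S B J v)"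

definition coercive_on :: "'a set \<Rightarrow> ('a \<Rightarrow> real) \<Rightarrow> ('a \<Rightarrow> 'a \<Rightarrow> real) \<Rightarrow> bool" where
  "coercive_on V N a \<longleftrightarrow> (\<exists>\<gamma>>0. \<forall>v\<in>V. a v v \<ge> \<gamma> * (N v)\<^sup>2)"

definition mixed_solution ::
  "('r::{real_inner,complete_space} \<Rightarrow> 'h::{real_inner,complete_space})
   \<Rightarrow> ('s::{real_inner,complete_space} \<Rightarrow> 'h)
   \<Rightarrow> ('r \<Rightarrow> 'r \<Rightarrow> real) \<Rightarrow> ('s \<Rightarrow> 's \<Rightarrow> real) \<Rightarrow> ('r \<Rightarrow> 's \<Rightarrow> real) \<Rightarrow> ('h \<Rightarrow> 'h \<Rightarrow> real)
   \<Rightarrow> ('r \<Rightarrow>\<^sub>L real) \<Rightarrow> ('s \<Rightarrow>\<^sub>L real) \<Rightarrow> 'r \<times> 's \<times> 'h \<Rightarrow> bool" where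
  "mixed_solution B J aR aS b c fR fS = (\<lambda>(u, \<phi>, \<zeta>).
     \<zeta> \<in> Y_space B J \<and>
     (\<forall>v \<psi>. \<forall>\<eta>\<in>Y_space B J.
        aR u v + b v \<phi> + c (B v) \<zeta> = blinfun_apply fR v \<and>
        b u \<psi> + aS \<phi> \<psi> - c (J \<psi>) \<zeta> = blinfun_apply fS \<psi> \<and>
        c (B u) \<eta> - c (J \<phi>) \<eta> = 0))"

end

theory Submission
  imports Defs
begin

text \<open>
  Eliminating \<open>\<phi> = B u\<close> turns the mixed problem into the primal problem for the energy form, which is
  an inner product on V equivalent to the given one, so \<open>u\<close> is a Riesz representative. The multiplier
  \<open>\<zeta>\<close> must represent the residual of the first two equations, as a functional of \<open>B v + \<psi>\<close>. This
  functional is well defined because the residual vanishes where \<open>B v + \<psi> = 0\<close>, by the primal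
  equation. The norm of Y controls only \<open>B r\<close> and not \<open>r\<close>, so boundedness of the functional is not
  immediate: it follows from the open mapping theorem for \<open>(r, s) \<mapsto> B r + s\<close>, a bounded map onto
  the complete space Y (\<open>B\<close> itself is bounded by the closed graph theorem). The same decomposition of
  \<open>\<zeta>\<close> as \<open>B r + s\<close> with \<open>r\<close> and \<open>s\<close> controlled by \<open>\<zeta>\<close> gives the stability estimate.
\<close>

section \<open>Hilbert spaces carried by subspaces\<close>

text \<open>Equivalent norms have the same Cauchy sequences and the same null sequences. This
  carries completeness to the three inner products built later: \<open>c\<close> on
  \<open>Y\<close>, the energy form on \<open>V\<close>, and the form \<open>d\<close> in the open
  mapping argument.\<close>

lemma complete_in_norm_equiv:
  assumes W: "subspace W" and c: "complete_in_norm W N2" and e: "norm_equiv_on W N1 N2"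
  shows "complete_in_norm W N1"
  unfolding complete_in_norm_def
proof (intro allI impI)
  fix x :: "nat \<Rightarrow> 'a"
  assume xW: "\<forall>n. x n \<in> W" and cau: "\<forall>e>0. \<exists>M. \<forall>m\<ge>M. \<forall>n\<ge>M. N1 (x m - x n) < e"
  obtain k K where k: "k > 0" "K > 0" "\<And>x. x \<in> W \<Longrightarrow> k * N2 x \<le> N1 x \<and> N1 x \<le> K * N2 x"
    using e unfolding norm_equiv_on_def by blast
  have "\<forall>e>0. \<exists>M. \<forall>m\<ge>M. \<forall>n\<ge>M. N2 (x m - x n) < e"
  proof (intro allI impI)
    fix e :: real assume "e > 0"
    then obtain M where M: "\<And>m n. m \<ge> M \<Longrightarrow> n \<ge> M \<Longrightarrow> N1 (x m - x n) < k * e"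
      using cau[rule_format, of "k * e"] k(1) by auto
    have "N2 (x m - x n) < e" if "m \<ge> M" "n \<ge> M" for m n
    proof -
      have "x m - x n \<in> W" using subspace_diff[OF W] xW by blast
      then have "k * N2 (x m - x n) < k * e"
        using M[OF that] k(3)[of "x m - x n"] by linarith
      then show ?thesis using k(1) by simp
    qed
    then show "\<exists>M. \<forall>m\<ge>M. \<forall>n\<ge>M. N2 (x m - x n) < e" by blast
  qed
  then obtain l where l: "l \<in> W" and lim: "(\<lambda>n. N2 (x n - l)) \<longlonglongrightarrow> 0"
    using c[unfolded complete_in_norm_def, rule_format, of x] xW by blast
  have "(\<lambda>n. N1 (x n - l)) \<longlonglongrightarrow> 0"
  proof (rule tendsto_sandwich)
    show "\<forall>\<^sub>F n in sequentially. k * N2 (x n - l) \<le> N1 (x n - l)"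
      and "\<forall>\<^sub>F n in sequentially. N1 (x n - l) \<le> K * N2 (x n - l)"
      using k(3)[OF subspace_diff[OF W xW[rule_format] l]] by simp_all
    show "(\<lambda>n. k * N2 (x n - l)) \<longlonglongrightarrow> 0" "(\<lambda>n. K * N2 (x n - l)) \<longlonglongrightarrow> 0"
      using tendsto_mult_right_zero[OF lim] by auto
  qed
  with l show "\<exists>l\<in>W. (\<lambda>n. N1 (x n - l)) \<longlonglongrightarrow> 0" by blast
qed

text \<open>The carrier is a set and \<open>ip\<close> is meaningful only there, so one subspace can
  carry several inner products at once, as \<open>V\<close> does with \<open>ipV\<close> and the
  energy form.\<close>

locale inner_product_subspace =
  fixes W :: "'a::real_vector set" and ip :: "'a \<Rightarrow> 'a \<Rightarrow> real"
  assumes inner_product: "inner_product_on W ip"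
begin

section \<open>Elementary geometry of an inner product on a subspace\<close>

abbreviation nrm :: "'a \<Rightarrow> real" where "nrm \<equiv> ip_norm ip"

lemma W_subspace: "subspace W"
  using inner_product unfolding inner_product_on_def by blast

lemma W_closed [simp, intro]:
  "0 \<in> W"
  "x \<in> W \<Longrightarrow> y \<in> W \<Longrightarrow> x + y \<in> W"
  "x \<in> W \<Longrightarrow> y \<in> W \<Longrightarrow> x - y \<in> W"
  "x \<in> W \<Longrightarrow> k *\<^sub>R x \<in> W"
  "x \<in> W \<Longrightarrow> - x \<in> W"
  using W_subspace
  by (auto simp: subspace_0 subspace_add subspace_diff subspace_scale subspace_neg)

lemma ip_commute: "x \<in> W \<Longrightarrow> y \<in> W \<Longrightarrow> ip x y = ip y x"
  by (rule inner_product[unfolded inner_product_on_def, THEN conjunct2, THEN conjunct1, rule_format])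

lemma ip_add_left: "x \<in> W \<Longrightarrow> y \<in> W \<Longrightarrow> z \<in> W \<Longrightarrow> ip (x + y) z = ip x z + ip y z"
  by (rule inner_product[unfolded inner_product_on_def, THEN conjunct2, THEN conjunct2, THEN conjunct1, rule_format])

lemma ip_scale_left: "x \<in> W \<Longrightarrow> y \<in> W \<Longrightarrow> ip (k *\<^sub>R x) y = k * ip x y"
  by (rule inner_product[unfolded inner_product_on_def, THEN conjunct2, THEN conjunct2, THEN conjunct2, THEN conjunct1, rule_format])

lemma ip_pos: "x \<in> W \<Longrightarrow> x \<noteq> 0 \<Longrightarrow> 0 < ip x x"
  by (rule inner_product[unfolded inner_product_on_def, THEN conjunct2, THEN conjunct2, THEN conjunct2, THEN conjunct2, rule_format])

lemma ip_add_right: "x \<in> W \<Longrightarrow> y \<in> W \<Longrightarrow> z \<in> W \<Longrightarrow> ip x (y + z) = ip x y + ip x z"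
  using ip_add_left[of y z x] ip_commute[of x "y + z"] ip_commute[of x y] ip_commute[of x z] by simp

lemma ip_scale_right: "x \<in> W \<Longrightarrow> y \<in> W \<Longrightarrow> ip x (k *\<^sub>R y) = k * ip x y"
  using ip_scale_left[of y x k] ip_commute[of x "k *\<^sub>R y"] ip_commute[of x y] by simp

lemma ip_minus_left: "x \<in> W \<Longrightarrow> y \<in> W \<Longrightarrow> ip (- x) y = - ip x y"
  using ip_scale_left[of x y "-1"] by simp

lemma ip_minus_right: "x \<in> W \<Longrightarrow> y \<in> W \<Longrightarrow> ip x (- y) = - ip x y"
  using ip_scale_right[of x y "-1"] by simp

lemma ip_diff_left: "x \<in> W \<Longrightarrow> y \<in> W \<Longrightarrow> z \<in> W \<Longrightarrow> ip (x - y) z = ip x z - ip y z"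
  using ip_add_left[of x "- y" z] by (simp add: ip_minus_left)

lemma ip_diff_right: "x \<in> W \<Longrightarrow> y \<in> W \<Longrightarrow> z \<in> W \<Longrightarrow> ip x (y - z) = ip x y - ip x z"
  using ip_add_right[of x y "- z"] by (simp add: ip_minus_right)

lemmas ip_simps = ip_add_left ip_add_right ip_scale_left ip_scale_right ip_minus_left
  ip_minus_right ip_diff_left ip_diff_right

lemma ip_zero [simp]: "x \<in> W \<Longrightarrow> ip 0 x = 0" "x \<in> W \<Longrightarrow> ip x 0 = 0"
  using ip_scale_left[of 0 x 0] ip_scale_right[of x 0 0] by auto

lemma ip_self_nonneg: "x \<in> W \<Longrightarrow> 0 \<le> ip x x"
  using ip_pos[of x] by (cases "x = 0") auto

lemma nrm_sq: "x \<in> W \<Longrightarrow> (nrm x)\<^sup>2 = ip x x"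
  by (simp add: ip_norm_def ip_self_nonneg)

lemma nrm_nonneg [simp]: "x \<in> W \<Longrightarrow> 0 \<le> nrm x"
  by (simp add: ip_norm_def ip_self_nonneg)

lemma nrm_pos: "x \<in> W \<Longrightarrow> x \<noteq> 0 \<Longrightarrow> 0 < nrm x"
  by (simp add: ip_norm_def ip_pos)

lemma nrm_zero [simp]: "nrm 0 = 0"
  by (simp add: ip_norm_def)

lemma nrm_scale: "x \<in> W \<Longrightarrow> nrm (k *\<^sub>R x) = \<bar>k\<bar> * nrm x"
proof -
  assume x: "x \<in> W"
  then have "ip (k *\<^sub>R x) (k *\<^sub>R x) = k\<^sup>2 * ip x x"
    by (simp add: ip_scale_left ip_scale_right power2_eq_square)
  then show ?thesis by (simp add: ip_norm_def real_sqrt_mult)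
qed

lemma nrm_diff_commute: "x \<in> W \<Longrightarrow> y \<in> W \<Longrightarrow> nrm (x - y) = nrm (y - x)"
  using nrm_scale[of "x - y" "-1"] by simp

lemma ip_eqI:
  assumes "x \<in> W" "y \<in> W" "\<And>w. w \<in> W \<Longrightarrow> ip x w = ip y w"
  shows "x = y"
proof (rule ccontr)
  assume "x \<noteq> y"
  then have "ip (x - y) (x - y) > 0" using assms(1,2) by (intro ip_pos) auto
  then show False using assms by (simp add: ip_diff_left)
qed

lemma Cauchy_Schwarz:
  assumes x: "x \<in> W" and y: "y \<in> W"
  shows "\<bar>ip x y\<bar> \<le> nrm x * nrm y"
proof (cases "y = 0")
  case False
  define t where "t = ip x y / ip y y"
  have pos: "ip y y > 0" using False y by (rule ip_pos[rotated])
  have "0 \<le> ip (x - t *\<^sub>R y) (x - t *\<^sub>R y)"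
    using x y by (intro ip_self_nonneg) auto
  also have "\<dots> = ip x x - t * ip x y"
    using x y pos by (simp add: ip_simps ip_commute[of y x] t_def field_simps)
  finally have "(ip x y)\<^sup>2 \<le> ip x x * ip y y"
    using pos by (simp add: t_def field_simps power2_eq_square)
  then have "\<bar>ip x y\<bar>\<^sup>2 \<le> (nrm x * nrm y)\<^sup>2"
    using x y by (simp add: nrm_sq power_mult_distrib)
  then show ?thesis by (rule power2_le_imp_le) (use x y in simp)
qed (use x in auto)

lemma nrm_triangle:
  assumes x: "x \<in> W" and y: "y \<in> W"
  shows "nrm (x + y) \<le> nrm x + nrm y"
proof (rule power2_le_imp_le)
  have "(nrm (x + y))\<^sup>2 = ip x x + 2 * ip x y + ip y y"
    using x y by (simp add: nrm_sq ip_simps ip_commute[of y x])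
  also have "\<dots> \<le> (nrm x + nrm y)\<^sup>2"
    using Cauchy_Schwarz[OF x y] x y by (simp add: power2_sum nrm_sq)
  finally show "(nrm (x + y))\<^sup>2 \<le> (nrm x + nrm y)\<^sup>2" .
qed (use x y in auto)

lemma nrm_triangle_diff:
  assumes "x \<in> W" "y \<in> W" "z \<in> W"
  shows "nrm (x - z) \<le> nrm (x - y) + nrm (y - z)"
  using nrm_triangle[of "x - y" "y - z"] assms by simp

end

section \<open>Consequences of completeness: Riesz representation and uniform boundedness\<close>

locale hilbert_subspace = inner_product_subspace +
  assumes complete: "complete_in_norm W (ip_norm ip)"
begin

text \<open>Minimising sequences of \<open>ip w w - 2 * l w\<close> are Cauchy by the parallelogram law, and their
  limit represents \<open>l\<close>.\<close>

lemma Riesz_representation: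
  assumes add: "\<And>x y. x \<in> W \<Longrightarrow> y \<in> W \<Longrightarrow> l (x + y) = l x + l y"
    and scale: "\<And>k x. x \<in> W \<Longrightarrow> l (k *\<^sub>R x) = k * l x"
    and bound: "\<And>x. x \<in> W \<Longrightarrow> \<bar>l x\<bar> \<le> K * nrm x"
  shows "\<exists>z\<in>W. \<forall>w\<in>W. ip z w = l w"
proof -
  define q where "q w = ip w w - 2 * l w" for w
  have low: "- K\<^sup>2 \<le> q w" if "w \<in> W" for w
  proof -
    have "0 \<le> (nrm w - K)\<^sup>2" by simp
    also have "\<dots> = ip w w - 2 * (K * nrm w) + K\<^sup>2"
      using that by (simp add: power2_diff nrm_sq)
    finally show ?thesis using bound[OF that] by (simp add: q_def)
  qed
  define m where "m = Inf (q ` W)"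
  have bdd: "bdd_below (q ` W)" using low by (auto intro!: bdd_belowI2)
  have ne: "q ` W \<noteq> {}" using W_closed(1) by blast
  have m: "m \<le> q w" if "w \<in> W" for w
    unfolding m_def using that bdd by (intro cInf_lower) auto
  have "\<exists>w\<in>W. q w < m + 1 / real (Suc n)" for n
  proof -
    have "Inf (q ` W) < m + 1 / real (Suc n)" by (simp add: m_def)
    then show ?thesis using cInf_lessD[OF ne] by blast
  qed
  then obtain w where w: "\<And>n. w n \<in> W" "\<And>n. q (w n) < m + 1 / real (Suc n)" by metis
  have close: "ip (w i - w j) (w i - w j) \<le> 2 / real (Suc i) + 2 / real (Suc j)" for i j
  proof -
    have "ip (w i - w j) (w i - w j)
        = 2 * q (w i) + 2 * q (w j) - 4 * q ((1/2) *\<^sub>R (w i + w j))"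
      using w(1)[of i] w(1)[of j]
      by (simp add: q_def ip_simps add scale ip_commute[of "w j" "w i"] algebra_simps del: scaleR_add_right)
    moreover have "m \<le> q ((1/2) *\<^sub>R (w i + w j))"
      using w(1) by (intro m) auto
    ultimately show ?thesis using w(2)[of i] w(2)[of j] by simp
  qed
  have "\<forall>e>0. \<exists>M. \<forall>i\<ge>M. \<forall>j\<ge>M. nrm (w i - w j) < e"
  proof (intro allI impI)
    fix e :: real assume e: "e > 0"
    then obtain M where M: "4 / real (Suc M) < e\<^sup>2"
      using reals_Archimedean[of "e\<^sup>2 / 4"] by (auto simp: field_simps)
    have "nrm (w i - w j) < e" if "i \<ge> M" "j \<ge> M" for i j
    proof (rule power2_less_imp_less)
      have "2 / real (Suc i) \<le> 2 / real (Suc M)" "2 / real (Suc j) \<le> 2 / real (Suc M)"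
        using that by (auto intro!: divide_left_mono)
      then have "ip (w i - w j) (w i - w j) < e\<^sup>2"
        using close[of i j] M by simp
      then show "(nrm (w i - w j))\<^sup>2 < e\<^sup>2" using w(1) by (simp add: nrm_sq)
    qed (use e in auto)
    then show "\<exists>M. \<forall>i\<ge>M. \<forall>j\<ge>M. nrm (w i - w j) < e" by blast
  qed
  then obtain z where z: "z \<in> W" and lim: "(\<lambda>n. nrm (w n - z)) \<longlonglongrightarrow> 0"
    using complete[unfolded complete_in_norm_def, rule_format, of w] w(1) by blast
  have "ip z v = l v" if v: "v \<in> W" for v
  proof (cases "v = 0")
    case True
    then show ?thesis using scale[of 0 0] z by simp
  next
    case False
    then have pos: "ip v v > 0" using v by (rule ip_pos[rotated])
    have le: "\<bar>ip (w n) v - l v\<bar> \<le> sqrt (1 / real (Suc n)) * nrm v" for n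
    proof -
      define e where "e = ip (w n) v - l v"
      \<comment> \<open>This \<open>t\<close> minimises \<open>q\<close> on the line through
        \<open>w n\<close> in direction \<open>v\<close>. The resulting decrease
        \<open>e\<^sup>2 / ip v v\<close> cannot exceed the gap between \<open>q (w n)\<close> and
        the infimum \<open>m\<close>, so \<open>w n\<close> represents \<open>l\<close> up to an
        error that vanishes.\<close>
      define t where "t = - e / ip v v"
      have "m \<le> q (w n + t *\<^sub>R v)" using w(1) v by (intro m) auto
      also have "\<dots> = q (w n) + (2 * t * e + t\<^sup>2 * ip v v)"
        using w(1)[of n] v
        by (simp add: q_def ip_simps add scale ip_commute[of v "w n"] e_def algebra_simps power2_eq_square)
      also have "2 * t * e + t\<^sup>2 * ip v v = - (e\<^sup>2 / ip v v)"
        using pos by (simp add: t_def power2_eq_square field_simps)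
      finally have "e\<^sup>2 / ip v v \<le> 1 / real (Suc n)"
        using w(2)[of n] by linarith
      then have "e\<^sup>2 \<le> 1 / real (Suc n) * ip v v" using pos by (simp add: divide_le_eq)
      then have "sqrt (e\<^sup>2) \<le> sqrt (1 / real (Suc n) * ip v v)" by (rule real_sqrt_le_mono)
      then show ?thesis by (simp only: real_sqrt_mult real_sqrt_abs ip_norm_def e_def)
    qed
    have "\<bar>ip z v - l v\<bar> \<le> (nrm (w n - z) + sqrt (1 / real (Suc n))) * nrm v" for n
    proof -
      have "ip z v - l v = (ip (w n) v - l v) - ip (w n - z) v"
        using z v w(1) by (simp add: ip_diff_left)
      then show ?thesis
        using le[of n] Cauchy_Schwarz[of "w n - z" v] z v w(1)[of n] by (simp add: distrib_right)
    qed
    moreover have "(\<lambda>n. (nrm (w n - z) + sqrt (1 / real (Suc n))) * nrm v) \<longlonglongrightarrow> (0 + sqrt 0) * nrm v"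
      by (intro tendsto_intros lim LIMSEQ_Suc[OF lim_1_over_n])
    ultimately have "\<bar>ip z v - l v\<bar> \<le> 0"
      using LIMSEQ_le_const[of _ _ "\<bar>ip z v - l v\<bar>"] by fastforce
    then show ?thesis by simp
  qed
  with z show ?thesis by blast
qed

text \<open>A gliding hump: the step towards \<open>y n\<close>, of length \<open>(1/3)^n\<close>, makes \<open>\<bar>ip z (y n)\<bar>\<close> large, and
  all later steps together can undo at most half of it.\<close>

lemma uniform_boundedness:
  assumes A: "A \<subseteq> W" and pointwise: "\<And>x. x \<in> W \<Longrightarrow> \<exists>K. \<forall>y\<in>A. \<bar>ip x y\<bar> \<le> K"
  shows "\<exists>K. \<forall>y\<in>A. nrm y \<le> K"
proof (rule ccontr)
  assume "\<not> ?thesis"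
  \<comment> \<open>Steps of length \<open>(1/3)^n\<close> against norms above \<open>4 ^ n\<close>
    leave \<open>(4/3)^n\<close>, which is unbounded.\<close>
  then have "\<exists>y\<in>A. nrm y > 4 ^ n" for n :: nat by (meson not_le)
  then obtain y where yA: "\<And>n :: nat. y n \<in> A" and y4: "\<And>n. nrm (y n) > 4 ^ n" by metis
  have yW [simp]: "y n \<in> W" for n using yA A by blast
  have ypos: "nrm (y n) > 0" for n using y4[of n] by (rule less_trans[rotated]) simp
  \<comment> \<open>The sign is that of \<open>ip x (y n)\<close>, so the step can only add to its
    absolute value; the division by \<open>nrm (y n)\<close> gives the step its prescribed
    length.\<close>
  define s where "s n x = (if ip x (y n) \<ge> 0 then 1 else - 1) * (1/3)^n / nrm (y n)" for n x
  define x where "x = rec_nat 0 (\<lambda>n x. x + s n x *\<^sub>R y n)"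
  have x_Suc: "x (Suc n) = x n + s n (x n) *\<^sub>R y n" for n by (simp add: x_def)
  have xW [simp]: "x n \<in> W" for n
    by (induction n) (simp_all add: x_Suc, simp add: x_def)
  have hump: "\<bar>ip (x (Suc n)) (y n)\<bar> \<ge> (1/3)^n * nrm (y n)" for n
  proof -
    have "ip (x (Suc n)) (y n) = ip (x n) (y n) + s n (x n) * (nrm (y n))\<^sup>2"
      by (simp add: x_Suc ip_simps nrm_sq)
    also have "s n (x n) * (nrm (y n))\<^sup>2
        = (if ip (x n) (y n) \<ge> 0 then 1 else - 1) * ((1/3)^n * nrm (y n))"
      using ypos[of n] by (simp add: s_def power2_eq_square)
    finally have "ip (x (Suc n)) (y n) = ip (x n) (y n)
        + (if ip (x n) (y n) \<ge> 0 then 1 else - 1) * ((1/3)^n * nrm (y n))" .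
    moreover have "h \<le> \<bar>a + (if a \<ge> 0 then 1 else - 1) * h\<bar>" if "h > 0" for a h :: real
      using that by auto
    ultimately show ?thesis using ypos[of n] by simp
  qed
  have step: "nrm (x (Suc n) - x n) = (1/3)^n" for n
    using ypos[of n] by (simp add: x_Suc nrm_scale s_def abs_mult)
  \<comment> \<open>The bound is the exact partial sum of the geometric series of step lengths,
    which is what lets the induction close.\<close>
  have tail: "nrm (x (n + k) - x n) \<le> 3/2 * (1/3)^n * (1 - (1/3)^k)" for n k
  proof (induction k)
    case (Suc k)
    have "nrm (x (n + Suc k) - x n) \<le> (1/3)^(n + k) + nrm (x (n + k) - x n)"
      using nrm_triangle_diff[of "x (Suc (n + k))" "x (n + k)" "x n"] step[of "n + k"] by simp
    then show ?case using Suc by (simp add: power_add algebra_simps)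
  qed simp
  have near: "nrm (x m - x n) \<le> 3/2 * (1/3)^n" if "m \<ge> n" for m n
  proof -
    have "nrm (x m - x n) \<le> 3/2 * (1/3)^n * (1 - (1/3)^(m - n))"
      using tail[of n "m - n"] that by simp
    also have "\<dots> \<le> 3/2 * (1/3)^n * 1" by (intro mult_left_mono) auto
    finally show ?thesis by simp
  qed
  have "\<exists>M. \<forall>i\<ge>M. \<forall>j\<ge>M. nrm (x i - x j) < e" if "e > 0" for e
  proof -
    obtain M where M: "(1/3 :: real)^M < e / 3"
      using real_arch_pow_inv[of "e / 3" "1/3"] \<open>e > 0\<close> by auto
    have "nrm (x i - x j) < e" if "i \<ge> M" "j \<ge> M" for i j
      using nrm_triangle_diff[of "x i" "x M" "x j"] near[OF that(1)] near[OF that(2)] M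
        nrm_diff_commute[of "x j" "x M"] by simp
    then show ?thesis by blast
  qed
  then obtain z where z [simp]: "z \<in> W" and lim: "(\<lambda>n. nrm (x n - z)) \<longlonglongrightarrow> 0"
    using complete[unfolded complete_in_norm_def, rule_format, of x] by auto
  have zn: "nrm (z - x n) \<le> 3/2 * (1/3)^n" for n
  proof (rule LIMSEQ_le_const)
    show "(\<lambda>m. nrm (x m - z) + 3/2 * (1/3)^n) \<longlonglongrightarrow> 3/2 * (1/3)^n"
      using tendsto_add[OF lim tendsto_const] by simp
    have "nrm (z - x n) \<le> nrm (x m - z) + 3/2 * (1/3)^n" if "m \<ge> n" for m
      using nrm_triangle_diff[of z "x m" "x n"] near[OF that] nrm_diff_commute[of z "x m"] by simp
    then show "\<exists>N. \<forall>m\<ge>N. nrm (z - x n) \<le> nrm (x m - z) + 3/2 * (1/3)^n" by blast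
  qed
  have big: "\<bar>ip z (y n)\<bar> \<ge> (4/3)^n / 2" for n
  proof -
    have "\<bar>ip (z - x (Suc n)) (y n)\<bar> \<le> nrm (z - x (Suc n)) * nrm (y n)"
      by (intro Cauchy_Schwarz) auto
    \<comment> \<open>The distance bound is taken at \<open>Suc n\<close>, after the step towards
      \<open>y n\<close>: there 3/2 times \<open>(1/3)^Suc n\<close> is exactly half of
      \<open>(1/3)^n\<close>.\<close>
    also have "\<dots> \<le> (3/2 * (1/3)^Suc n) * nrm (y n)"
      using ypos[of n] by (intro mult_right_mono zn) auto
    finally have "\<bar>ip z (y n) - ip (x (Suc n)) (y n)\<bar> \<le> (1/3)^n * nrm (y n) / 2"
      by (simp add: ip_diff_left)
    moreover have "\<bar>s\<bar> \<ge> h / 2" if "\<bar>s - t\<bar> \<le> h / 2" "\<bar>t\<bar> \<ge> h" for s t h :: real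
      using that by linarith
    ultimately have "\<bar>ip z (y n)\<bar> \<ge> (1/3)^n * nrm (y n) / 2"
      using hump[of n] by blast
    moreover have "(1/3)^n * nrm (y n) \<ge> (1/3)^n * 4^n"
      using y4[of n] by (intro mult_left_mono) auto
    moreover have "(1/3)^n * 4^n = (4/3 :: real)^n"
      by (simp flip: power_mult_distrib)
    ultimately show ?thesis by simp
  qed
  obtain K where K: "\<And>n. \<bar>ip z (y n)\<bar> \<le> K" using pointwise[OF z] yA by blast
  obtain n where "2 * K < (4/3 :: real)^n" using real_arch_pow[of "4/3" "2 * K"] by auto
  with big[of n] K[of n] show False by simp
qed

end

section \<open>Open mapping and closed graph\<close>

text \<open>The adjoint of a surjection is injective, and bounded below by uniform boundedness; hence
  \<open>T T*\<close> can be inverted by the Riesz theorem, and \<open>T* (T T*)\<inverse>\<close> is a bounded right inverse.\<close>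

lemma hilbert_open_mapping:
  assumes hX: "hilbert_subspace X ipX" and hW: "hilbert_subspace W ipW"
    and TW: "\<And>x. x \<in> X \<Longrightarrow> T x \<in> W"
    and add: "\<And>x y. x \<in> X \<Longrightarrow> y \<in> X \<Longrightarrow> T (x + y) = T x + T y"
    and scale: "\<And>k x. x \<in> X \<Longrightarrow> T (k *\<^sub>R x) = k *\<^sub>R T x"
    and bound: "\<And>x. x \<in> X \<Longrightarrow> ip_norm ipW (T x) \<le> K * ip_norm ipX x"
    and surj: "\<And>y. y \<in> W \<Longrightarrow> \<exists>x\<in>X. T x = y"
  shows "\<exists>C>0. \<forall>y\<in>W. \<exists>x\<in>X. T x = y \<and> ip_norm ipX x \<le> C * ip_norm ipW y"
proof -
  interpret X: hilbert_subspace X ipX by (rule hX)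
  interpret W: hilbert_subspace W ipW by (rule hW)
  \<comment> \<open>Riesz in \<open>X\<close> constructs the adjoint of \<open>T\<close>, called
    \<open>A\<close> below.\<close>
  have "\<exists>a\<in>X. \<forall>x\<in>X. ipX a x = ipW (T x) y" if y: "y \<in> W" for y
  proof (rule X.Riesz_representation)
    fix x assume x: "x \<in> X"
    have "\<bar>ipW (T x) y\<bar> \<le> W.nrm (T x) * W.nrm y" using x y by (intro W.Cauchy_Schwarz TW)
    also have "\<dots> \<le> (K * X.nrm x) * W.nrm y" using x y by (intro mult_right_mono bound) auto
    finally show "\<bar>ipW (T x) y\<bar> \<le> (K * W.nrm y) * X.nrm x" by (simp add: ac_simps)
  qed (use y in \<open>simp_all add: add scale TW W.ip_simps\<close>)
  then obtain A where AX [simp]: "\<And>y. y \<in> W \<Longrightarrow> A y \<in> X"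
    and A: "\<And>x y. y \<in> W \<Longrightarrow> x \<in> X \<Longrightarrow> ipX (A y) x = ipW (T x) y"
    by metis
  have A_add: "A (y + z) = A y + A z" if "y \<in> W" "z \<in> W" for y z
    using that by (intro X.ip_eqI) (auto simp: A X.ip_simps W.ip_simps TW)
  have A_scale: "A (k *\<^sub>R y) = k *\<^sub>R A y" if "y \<in> W" for k y
    using that by (intro X.ip_eqI) (auto simp: A X.ip_simps W.ip_simps TW)
  have A_nz: "A y \<noteq> 0" if y: "y \<in> W" "y \<noteq> 0" for y
  proof
    assume "A y = 0"
    obtain x where x: "x \<in> X" "T x = y" using surj y by blast
    then have "ipW y y = 0" using A[of y x] y \<open>A y = 0\<close> by simp
    then show False using W.ip_pos[OF y] by simp
  qed
  have A_bound: "X.nrm (A y) \<le> K * W.nrm y" if y: "y \<in> W" for y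
  proof (cases "y = 0")
    case True
    then show ?thesis using A_scale[of 0 0] by simp
  next
    case False
    then have pos: "X.nrm (A y) > 0" using y A_nz X.nrm_pos by auto
    have "(X.nrm (A y))\<^sup>2 = ipW (T (A y)) y" using y by (simp add: A X.nrm_sq)
    also have "\<dots> \<le> W.nrm (T (A y)) * W.nrm y"
      using W.Cauchy_Schwarz[of "T (A y)" y] y TW by auto
    also have "\<dots> \<le> (K * X.nrm (A y)) * W.nrm y" using y by (intro mult_right_mono bound) auto
    finally show ?thesis using pos by (simp add: power2_eq_square)
  qed
  \<comment> \<open>On the set where \<open>A y\<close> has norm at most 1, pairing with
    \<open>w = T x\<close> equals \<open>ipX (A y) x\<close> and is at most the norm of
    \<open>x\<close>. So surjectivity of \<open>T\<close> gives pointwise boundedness, and uniform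
    boundedness then bounds the set in norm.\<close>
  obtain C0 where C0: "\<And>y. y \<in> W \<Longrightarrow> X.nrm (A y) \<le> 1 \<Longrightarrow> W.nrm y \<le> C0"
  proof -
    have "\<exists>C. \<forall>y \<in> {y\<in>W. X.nrm (A y) \<le> 1}. W.nrm y \<le> C"
    proof (rule W.uniform_boundedness)
      fix w assume "w \<in> W"
      then obtain x where x: "x \<in> X" "T x = w" using surj by blast
      have "\<bar>ipW w y\<bar> \<le> X.nrm x" if "y \<in> W" "X.nrm (A y) \<le> 1" for y
      proof -
        have "\<bar>ipW w y\<bar> \<le> X.nrm (A y) * X.nrm x"
          using X.Cauchy_Schwarz[of "A y" x] that x A[of y x] by simp
        also have "\<dots> \<le> 1 * X.nrm x" using that x by (intro mult_right_mono) auto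
        finally show ?thesis by simp
      qed
      then show "\<exists>K. \<forall>y\<in>{y \<in> W. X.nrm (A y) \<le> 1}. \<bar>ipW w y\<bar> \<le> K" by blast
    qed auto
    then show thesis using that by blast
  qed
  \<comment> \<open>Nothing is known about the sign of \<open>C0\<close>, while
    \<open>norm_equiv_on\<close> asks for strictly positive constants.\<close>
  define C where "C = \<bar>C0\<bar> + 1"
  have C: "C > 0" by (simp add: C_def)
  have below: "W.nrm y \<le> C * X.nrm (A y)" if y: "y \<in> W" for y
  proof (cases "y = 0")
    case True
    then show ?thesis using A_scale[of 0 0] by simp
  next
    case False
    then have pos: "X.nrm (A y) > 0" using y A_nz X.nrm_pos by auto
    have "W.nrm (inverse (X.nrm (A y)) *\<^sub>R y) \<le> C0"
      using y pos by (intro C0) (auto simp: A_scale X.nrm_scale)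
    then have "W.nrm y \<le> C0 * X.nrm (A y)"
      using y pos by (simp add: W.nrm_scale field_simps)
    also have "\<dots> \<le> C * X.nrm (A y)" using pos by (intro mult_right_mono) (auto simp: C_def)
    finally show ?thesis .
  qed
  \<comment> \<open>The form of the operator \<open>T A\<close> on \<open>W\<close>. Injectivity of
    \<open>A\<close> makes it definite; the bounds on \<open>A\<close> from above and below make its
    norm equivalent to that of \<open>ipW\<close>, hence complete.\<close>
  define d where "d y z = ipX (A y) (A z)" for y z
  have d_norm: "ip_norm d y = X.nrm (A y)" for y by (simp add: d_def ip_norm_def)
  have "inner_product_on W d"
    unfolding inner_product_on_def d_def
    using W.W_subspace by (auto simp: A_add A_scale X.ip_simps X.ip_commute intro!: X.ip_pos dest: A_nz)
  moreover have "complete_in_norm W (ip_norm d)"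
  proof (rule complete_in_norm_equiv[OF W.W_subspace W.complete])
    have "1 / C * W.nrm y \<le> ip_norm d y \<and> ip_norm d y \<le> (\<bar>K\<bar> + 1) * W.nrm y" if y: "y \<in> W" for y
    proof -
      have "K * W.nrm y \<le> (\<bar>K\<bar> + 1) * W.nrm y" using y by (intro mult_right_mono) auto
      then show ?thesis
        using below[OF y] A_bound[OF y] C by (simp add: d_norm field_simps)
    qed
    then show "norm_equiv_on W (ip_norm d) W.nrm"
      unfolding norm_equiv_on_def using C
      by (intro exI[of _ "1 / C"] exI[of _ "\<bar>K\<bar> + 1"] conjI) auto
  qed
  ultimately interpret D: hilbert_subspace W d by unfold_locales
  have "\<exists>x\<in>X. T x = y \<and> X.nrm x \<le> C * W.nrm y" if y: "y \<in> W" for y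
  proof -
    \<comment> \<open>Riesz for \<open>d\<close> solves \<open>T (A z) = y\<close>, so
      \<open>A z\<close> is the desired preimage.\<close>
    have "\<exists>z\<in>W. \<forall>w\<in>W. d z w = ipW y w"
    proof (rule D.Riesz_representation)
      fix w assume w: "w \<in> W"
      have "\<bar>ipW y w\<bar> \<le> W.nrm y * W.nrm w" using y w by (rule W.Cauchy_Schwarz)
      also have "\<dots> \<le> W.nrm y * (C * X.nrm (A w))" using y w by (intro mult_left_mono below) auto
      finally show "\<bar>ipW y w\<bar> \<le> (W.nrm y * C) * ip_norm d w" by (simp add: d_norm)
    qed (use y in \<open>simp_all add: W.ip_simps\<close>)
    then obtain z where z: "z \<in> W" and dz: "\<And>w. w \<in> W \<Longrightarrow> d z w = ipW y w" by blast
    have "T (A z) = y"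
      using z y TW dz A by (intro W.ip_eqI) (auto simp: d_def X.ip_commute)
    moreover have "X.nrm (A z) \<le> C * W.nrm y"
    proof (cases "z = 0")
      case True
      then show ?thesis using A_scale[of 0 0] y C by simp
    next
      case False
      then have pos: "X.nrm (A z) > 0" using z A_nz X.nrm_pos by auto
      have "(X.nrm (A z))\<^sup>2 = ipW y z" using z dz[OF z] by (simp add: d_def X.nrm_sq)
      also have "\<dots> \<le> W.nrm y * W.nrm z" using W.Cauchy_Schwarz[OF y z] by simp
      also have "\<dots> \<le> W.nrm y * (C * X.nrm (A z))" using y z by (intro mult_left_mono below) auto
      finally show ?thesis using pos by (simp add: power2_eq_square mult.commute)
    qed
    ultimately show ?thesis using z by (intro bexI[of _ "A z"]) simp_all
  qed
  with C show ?thesis by (intro exI[of _ C]) simp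
qed

lemma ip_norm_inner [simp]: "ip_norm inner = norm"
  by (simp add: fun_eq_iff ip_norm_def norm_eq_sqrt_inner)

lemma hilbert_subspace_UNIV: "hilbert_subspace (UNIV :: 'a::{real_inner,complete_space} set) inner"
proof
  show "inner_product_on (UNIV :: 'a set) inner"
    by (auto simp: inner_product_on_def inner_commute inner_add_right)
  show "complete_in_norm (UNIV :: 'a set) (ip_norm inner)"
    unfolding complete_in_norm_def ip_norm_inner
  proof (intro allI impI)
    fix x :: "nat \<Rightarrow> 'a"
    assume "\<forall>e>0. \<exists>M. \<forall>m\<ge>M. \<forall>n\<ge>M. norm (x m - x n) < e"
    then have "Cauchy x" by (simp add: Cauchy_def dist_norm)
    then obtain l where "x \<longlonglongrightarrow> l" using Cauchy_convergent convergentD by blast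
    then show "\<exists>l\<in>UNIV. (\<lambda>n. norm (x n - l)) \<longlonglongrightarrow> 0"
      using tendsto_norm_zero LIM_zero by blast
  qed
qed

text \<open>Closedness of the graph says that the graph inner product is complete; open mapping for the
  identity then compares it with the original one.\<close>

lemma closed_graph_bounded_linear:
  fixes B :: "'r::{real_inner,complete_space} \<Rightarrow> 'h::{real_inner,complete_space}"
  assumes lin: "linear B" and clo: "closed {(r, h). h = B r}"
  shows "bounded_linear B"
proof -
  define g where "g x y = inner x y + inner (B x) (B y)" for x y
  have g_norm: "ip_norm g x = sqrt ((norm x)\<^sup>2 + (norm (B x))\<^sup>2)" for x
    by (simp add: ip_norm_def g_def power2_norm_eq_inner)
  have le: "norm x \<le> ip_norm g x" "norm (B x) \<le> ip_norm g x" for x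
    by (simp_all add: g_norm real_le_rsqrt)
  have "hilbert_subspace UNIV g"
  proof
    show "inner_product_on UNIV g"
      unfolding inner_product_on_def
    proof (intro conjI ballI allI impI)
      fix x y z :: 'r and k :: real
      show "g x y = g y x" by (simp add: g_def inner_commute)
      show "g (x + y) z = g x z + g y z" by (simp add: g_def linear_add[OF lin] inner_add_left)
      show "g (k *\<^sub>R x) y = k * g x y" by (simp add: g_def linear_scale[OF lin] distrib_left)
      show "g x x > 0" if "x \<noteq> 0" using that by (simp add: g_def add_pos_nonneg)
    qed simp
    show "complete_in_norm UNIV (ip_norm g)"
      unfolding complete_in_norm_def
    proof (intro allI impI)
      fix x :: "nat \<Rightarrow> 'r"
      assume cau: "\<forall>e>0. \<exists>M. \<forall>m\<ge>M. \<forall>n\<ge>M. ip_norm g (x m - x n) < e"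
      \<comment> \<open>Stated for an arbitrary metric target, since it serves both \<open>x\<close>
        and its image under \<open>B\<close>.\<close>
      have Cauchy: "Cauchy f" if f: "\<And>m n. dist (f m) (f n) \<le> ip_norm g (x m - x n)"
        for f :: "nat \<Rightarrow> 'b::metric_space"
      proof (rule metric_CauchyI)
        fix e :: real assume "e > 0"
        then obtain M where "\<forall>m\<ge>M. \<forall>n\<ge>M. ip_norm g (x m - x n) < e" using cau by blast
        then show "\<exists>M. \<forall>m\<ge>M. \<forall>n\<ge>M. dist (f m) (f n) < e"
          by (intro exI[of _ M] allI impI le_less_trans[OF f]) simp
      qed
      have "Cauchy x" "Cauchy (\<lambda>n. B (x n))"
        using le by (auto intro!: Cauchy simp: dist_norm simp flip: linear_diff[OF lin])
      then obtain l h where lim: "x \<longlonglongrightarrow> l" "(\<lambda>n. B (x n)) \<longlonglongrightarrow> h"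
        unfolding Cauchy_convergent_iff convergent_def by blast
      have "(l, h) \<in> {(r, h). h = B r}"
        by (rule closed_sequentially[OF clo _ tendsto_Pair[OF lim]]) simp
      then have h: "h = B l" by simp
      have "(\<lambda>n. sqrt ((norm (x n - l))\<^sup>2 + (norm (B (x n) - B l))\<^sup>2)) \<longlonglongrightarrow> sqrt (0\<^sup>2 + 0\<^sup>2)"
        using lim h by (intro tendsto_intros tendsto_norm_zero LIM_zero) auto
      then show "\<exists>l\<in>UNIV. (\<lambda>n. ip_norm g (x n - l)) \<longlonglongrightarrow> 0"
        by (auto simp: g_norm linear_diff[OF lin])
    qed
  qed
  then have "\<exists>C>0. \<forall>y\<in>UNIV. \<exists>x\<in>UNIV. x = y \<and> ip_norm g x \<le> C * ip_norm inner y"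
    by (rule hilbert_open_mapping[OF _ hilbert_subspace_UNIV, where K = 1]) (use le(1) in simp_all)
  then obtain C where C: "\<And>x. ip_norm g x \<le> C * norm x" by auto
  have "norm (B x) \<le> norm x * C" for x
    using le(2)[of x] C[of x] by (simp add: mult.commute)
  with lin show ?thesis by (auto simp: linear_iff intro!: bounded_linear_intro[where K = C])
qed

section \<open>The mixed problem\<close>

locale mixed_problem =
  fixes B :: "'r::{real_inner,complete_space} \<Rightarrow> 'h::{real_inner,complete_space}"
    and J :: "'s::{real_inner,complete_space} \<Rightarrow> 'h"
    and V :: "'r set" and ipV :: "'r \<Rightarrow> 'r \<Rightarrow> real"
    and c :: "'h \<Rightarrow> 'h \<Rightarrow> real"
    and aR :: "'r \<Rightarrow> 'r \<Rightarrow> real" and aS :: "'s \<Rightarrow> 's \<Rightarrow> real" and b :: "'r \<Rightarrow> 's \<Rightarrow> real"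
  assumes triple: "configurable B J"
    and V: "configurated_by V ipV B J"
    and Y_complete: "complete_in_norm (Y_space B J) (Y_norm B J)"
    and c_inner: "inner_product_on (Y_space B J) c"
    and c_norm: "norm_equiv_on (Y_space B J) (ip_norm c) (Y_norm B J)"
    and aR: "bounded_bilinear aR" and aR_sym: "symmetric_form aR"
    and aS: "bounded_bilinear aS" and aS_sym: "symmetric_form aS"
    and b: "bounded_bilinear b"
    and coercive: "coercive_on V (ip_norm ipV) (primal_form B J aR aS b)"
begin

section \<open>Structure of \<open>V\<close> and \<open>Y\<close>, and the lift of \<open>B\<close>
  into S\<close>

abbreviation Y where "Y \<equiv> Y_space B J"
abbreviation lift where "lift \<equiv> lift_S B J"
abbreviation a where "a \<equiv> primal_form B J aR aS b"

sublocale aR: bounded_bilinear aR by (rule aR)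
sublocale aS: bounded_bilinear aS by (rule aS)
sublocale b: bounded_bilinear b by (rule b)
sublocale J: bounded_linear J using triple by (simp add: configurable_def)
sublocale B: bounded_linear B
  using triple by (auto simp: configurable_def intro: closed_graph_bounded_linear)

lemma J_eq_iff: "J x = J y \<longleftrightarrow> x = y"
  using triple by (auto simp: configurable_def inj_eq)

sublocale Y: inner_product_subspace Y c
  by unfold_locales (rule c_inner)

sublocale Y: hilbert_subspace Y c
  by unfold_locales (rule complete_in_norm_equiv[OF Y.W_subspace Y_complete c_norm])

sublocale V: inner_product_subspace V ipV
  using V unfolding configurated_by_def hilbert_space_on_def by unfold_locales blast

lemma mem_V: "w \<in> V \<longleftrightarrow> (\<exists>s. B w = J s)"
  using V by (auto simp: configurated_by_def)

lemma lift_eq: "B w = J s \<Longrightarrow> lift w = s"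
  by (metis J_eq_iff f_inv_into_f lift_S_def rangeI)

lemma J_lift: "w \<in> V \<Longrightarrow> J (lift w) = B w"
  by (auto simp: mem_V lift_eq)

lemma lift_add: "v \<in> V \<Longrightarrow> w \<in> V \<Longrightarrow> lift (v + w) = lift v + lift w"
  by (rule lift_eq) (simp add: B.add J.add J_lift)

lemma lift_scale: "w \<in> V \<Longrightarrow> lift (k *\<^sub>R w) = k *\<^sub>R lift w"
  by (rule lift_eq) (simp add: B.scaleR J.scaleR J_lift)

section \<open>The sum map from R x S onto \<open>Y\<close>\<close>

lemma mem_Y [simp]: "B r + J s \<in> Y" "B r \<in> Y" "J s \<in> Y"
proof -
  show *: "B r + J s \<in> Y" for r s by (auto simp: Y_space_def)
  show "B r \<in> Y" "J s \<in> Y" using *[of r 0] *[of 0 s] by (simp_all add: B.zero J.zero)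
qed

lemma Y_norm_le: "Y_norm B J (B r + J s) \<le> norm (B r) + norm s"
  unfolding Y_norm_def by (rule cInf_lower) (auto intro!: bdd_belowI[of _ 0])

text \<open>The pair \<open>(r, s)\<close> is itself a competitor in the infimum
  \<open>Y_norm\<close>, and boundedness of \<open>B\<close> replaces \<open>norm (B r)\<close> by a
  multiple of \<open>norm r\<close>. This continuity of the sum map is what open mapping requires,
  and it also gives the lower stability bound.\<close>

lemma sum_bound: "\<exists>L>0. \<forall>r s. Y.nrm (B r + J s) \<le> L * (norm r + norm s)"
proof -
  obtain K where K: "K > 0" "\<And>y. y \<in> Y \<Longrightarrow> Y.nrm y \<le> K * Y_norm B J y"
    using c_norm unfolding norm_equiv_on_def by blast
  obtain M where M: "M > 0" "\<And>r. norm (B r) \<le> norm r * M" using B.pos_bounded by blast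
  have "Y.nrm (B r + J s) \<le> K * (M + 1) * (norm r + norm s)" for r s
  proof -
    have "Y.nrm (B r + J s) \<le> K * Y_norm B J (B r + J s)" by (intro K) simp
    also have "\<dots> \<le> K * ((M + 1) * (norm r + norm s))"
    proof (rule mult_left_mono)
      have "0 \<le> M * norm s" "0 \<le> norm r" using M by simp_all
      then show "Y_norm B J (B r + J s) \<le> (M + 1) * (norm r + norm s)"
        using Y_norm_le[of r s] M(2)[of r] by (simp only: algebra_simps)
    qed (use K in simp)
    finally show ?thesis by (simp add: mult.assoc)
  qed
  then show ?thesis using K M by (intro exI[of _ "K * (M + 1)"]) simp
qed

text \<open>Open mapping for the sum map. The gain over the definition of \<open>Y_norm\<close> is
  control of \<open>r\<close> itself in R, not only of \<open>B r\<close> in H.\<close>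

lemma stable_decomposition:
  "\<exists>C>0. \<forall>y\<in>Y. \<exists>r s. y = B r + J s \<and> norm (r, s) \<le> C * Y.nrm y"
proof -
  obtain L where L: "L > 0" "\<And>r s. Y.nrm (B r + J s) \<le> L * (norm r + norm s)"
    using sum_bound by blast
  have "\<exists>C>0. \<forall>y\<in>Y. \<exists>p\<in>UNIV. (case p of (r, s) \<Rightarrow> B r + J s) = y \<and> ip_norm inner p \<le> C * Y.nrm y"
  proof (rule hilbert_open_mapping[OF hilbert_subspace_UNIV Y.hilbert_subspace_axioms])
    fix p :: "'r \<times> 's"
    obtain r s where p: "p = (r, s)" by (cases p)
    have "Y.nrm (B r + J s) \<le> L * (norm r + norm s)" by (rule L)
    also have "\<dots> \<le> L * (norm p + norm p)"
      using L(1) norm_fst_le[of r s] norm_snd_le[of s r] by (intro mult_left_mono) (auto simp: p)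
    finally show "Y.nrm (case p of (r, s) \<Rightarrow> B r + J s) \<le> (2 * L) * ip_norm inner p"
      by (simp add: p)
  qed (auto simp: B.add J.add B.scaleR J.scaleR algebra_simps Y_space_def)
  then show ?thesis by fastforce
qed

section \<open>Bounds for the forms, and the energy inner product on \<open>V\<close>\<close>

lemma forms_bound:
  "\<exists>K>0. (\<forall>x y. \<bar>aR x y\<bar> \<le> K * norm x * norm y) \<and> (\<forall>x y. \<bar>b x y\<bar> \<le> K * norm x * norm y) \<and>
     (\<forall>x y. \<bar>aS x y\<bar> \<le> K * norm x * norm y)"
proof -
  obtain K1 where K1: "K1 > 0" "\<And>x y. \<bar>aR x y\<bar> \<le> norm x * norm y * K1"
    using aR.pos_bounded by auto
  obtain K2 where K2: "K2 > 0" "\<And>x y. \<bar>b x y\<bar> \<le> norm x * norm y * K2"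
    using b.pos_bounded by auto
  obtain K3 where K3: "K3 > 0" "\<And>x y. \<bar>aS x y\<bar> \<le> norm x * norm y * K3"
    using aS.pos_bounded by auto
  define K where "K = K1 + K2 + K3"
  have mono: "norm x * norm y * k \<le> K * norm x * norm y" if "k \<le> K"
    for k and x :: "'x::real_normed_vector" and y :: "'y::real_normed_vector"
    using mult_left_mono[OF that, of "norm x * norm y"] by (simp add: ac_simps)
  have "K1 \<le> K" "K2 \<le> K" "K3 \<le> K" "K > 0" using K1 K2 K3 by (auto simp: K_def)
  then show ?thesis
    using order_trans[OF K1(2) mono] order_trans[OF K2(2) mono] order_trans[OF K3(2) mono]
    by (intro exI[of _ K]) simp
qed

text \<open>Coercivity combined with the norm equivalence on \<open>V\<close>. It is proved before
  \<open>a\<close> is known to be an inner product, and is what later shows that \<open>a\<close> is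
  definite.\<close>

lemma energy_lower: "\<exists>m>0. \<forall>v\<in>V. m * (norm v + norm (lift v)) \<le> ip_norm a v"
proof -
  obtain k where k: "k > 0" "\<And>v. v \<in> V \<Longrightarrow> k * (norm v + norm (lift v)) \<le> V.nrm v"
    using V unfolding configurated_by_def norm_equiv_on_def by blast
  obtain \<gamma> where g: "\<gamma> > 0" "\<And>v. v \<in> V \<Longrightarrow> \<gamma> * (V.nrm v)\<^sup>2 \<le> a v v"
    using coercive unfolding coercive_on_def by blast
  have "sqrt \<gamma> * k * (norm v + norm (lift v)) \<le> ip_norm a v" if v: "v \<in> V" for v
  proof -
    have "sqrt \<gamma> * (k * (norm v + norm (lift v))) \<le> sqrt \<gamma> * V.nrm v"
      using g k v by (intro mult_left_mono) auto
    also have "\<dots> = sqrt (\<gamma> * (V.nrm v)\<^sup>2)" using v by (simp add: real_sqrt_mult)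
    also have "\<dots> \<le> ip_norm a v" unfolding ip_norm_def[of a] using g(2)[OF v] by (rule real_sqrt_le_mono)
    finally show ?thesis by (simp add: mult.assoc)
  qed
  then show ?thesis using g k by (intro exI[of _ "sqrt \<gamma> * k"]) auto
qed

lemma energy_upper: "\<exists>M>0. \<forall>v\<in>V. ip_norm a v \<le> M * (norm v + norm (lift v))"
proof -
  obtain K where K: "K > 0" "\<And>x y. \<bar>aR x y\<bar> \<le> K * norm x * norm y"
    "\<And>x y. \<bar>b x y\<bar> \<le> K * norm x * norm y" "\<And>x y. \<bar>aS x y\<bar> \<le> K * norm x * norm y"
    using forms_bound by blast
  have "ip_norm a v \<le> sqrt K * (norm v + norm (lift v))" for v
  proof -
    \<comment> \<open>With one common constant \<open>K\<close>, the bounds for the diagonal terms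
      and the two equal cross terms add up to \<open>K\<close> times a perfect square.\<close>
    have "a v v \<le> K * (norm v + norm (lift v))\<^sup>2"
      unfolding primal_form_def
      using K(2)[of v v] K(3)[of v "lift v"] K(4)[of "lift v" "lift v"]
      by (simp add: power2_eq_square algebra_simps)
    then have "ip_norm a v \<le> sqrt (K * (norm v + norm (lift v))\<^sup>2)"
      unfolding ip_norm_def by (rule real_sqrt_le_mono)
    then show ?thesis by (simp add: real_sqrt_mult)
  qed
  then show ?thesis using K by (intro exI[of _ "sqrt K"]) auto
qed

text \<open>The two energy bounds and the norm equivalence for \<open>ipV\<close> both compare with
  \<open>norm v + norm (lift v)\<close>. Passing through this quantity makes the energy norm
  equivalent to that of \<open>V\<close>, so completeness transfers.\<close>

sublocale energy: hilbert_subspace V a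
proof
  obtain m where m: "m > 0" "\<And>v. v \<in> V \<Longrightarrow> m * (norm v + norm (lift v)) \<le> ip_norm a v"
    using energy_lower by blast
  obtain M where M: "M > 0" "\<And>v. v \<in> V \<Longrightarrow> ip_norm a v \<le> M * (norm v + norm (lift v))"
    using energy_upper by blast
  obtain k K where k: "k > 0" "\<And>v. v \<in> V \<Longrightarrow> k * (norm v + norm (lift v)) \<le> V.nrm v"
    and K: "K > 0" "\<And>v. v \<in> V \<Longrightarrow> V.nrm v \<le> K * (norm v + norm (lift v))"
    using V unfolding configurated_by_def norm_equiv_on_def by blast
  have pos: "a v v > 0" if "v \<in> V" "v \<noteq> 0" for v
  proof -
    have "0 < m * (norm v + norm (lift v))" using m(1) that(2) by (simp add: add_pos_nonneg)
    then have "0 < ip_norm a v" using m(2)[OF that(1)] by linarith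
    then show ?thesis by (simp add: ip_norm_def)
  qed
  have sym: "aR x y = aR y x" "aS x' y' = aS y' x'" for x y x' y'
    using aR_sym aS_sym by (auto simp: symmetric_form_def)
  show "inner_product_on V a"
    unfolding inner_product_on_def
  proof (intro conjI ballI allI impI)
    fix x y z k assume V: "x \<in> V" "y \<in> V"
    show "a x y = a y x"
      using sym(1)[of x y] sym(2)[of "lift x" "lift y"] unfolding primal_form_def by linarith
    show "a (x + y) z = a x z + a y z"
      using V by (simp add: primal_form_def lift_add aR.add_left aS.add_left b.add_left b.add_right)
    show "a (k *\<^sub>R x) y = k * a x y"
      using V by (simp add: primal_form_def lift_scale aR.scaleR_left aS.scaleR_left b.scaleR_left
          b.scaleR_right distrib_left)
  qed (use V.W_subspace pos in auto)
  show "complete_in_norm V (ip_norm a)"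
  proof (rule complete_in_norm_equiv[OF V.W_subspace])
    show "complete_in_norm V V.nrm"
      using V unfolding configurated_by_def hilbert_space_on_def by blast
    have "m / K * V.nrm v \<le> ip_norm a v \<and> ip_norm a v \<le> M / k * V.nrm v" if v: "v \<in> V" for v
    proof
      have "m * (V.nrm v / K) \<le> m * (norm v + norm (lift v))"
        using K(1) K(2)[OF v] m(1) by (intro mult_left_mono) (auto simp: field_simps)
      then show "m / K * V.nrm v \<le> ip_norm a v" using m(2)[OF v] by simp
      have "M * (norm v + norm (lift v)) \<le> M * (V.nrm v / k)"
        using k(1) k(2)[OF v] M(1) by (intro mult_left_mono) (auto simp: field_simps)
      then show "ip_norm a v \<le> M / k * V.nrm v" using M(2)[OF v] by simp
    qed
    then show "norm_equiv_on V (ip_norm a) V.nrm"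
      unfolding norm_equiv_on_def using m(1) M(1) k(1) K(1)
      by (intro exI[of _ "m / K"] exI[of _ "M / k"] conjI ballI) auto
  qed
qed

section \<open>The mixed system: primal reduction, existence, stability and uniqueness\<close>

abbreviation solution where "solution \<equiv> mixed_solution B J aR aS b c"

text \<open>Since \<open>c\<close> is definite on \<open>Y\<close>, testing the third equation with
  all of \<open>Y\<close> forces \<open>B u = J \<phi>\<close>. In the definition the first two
  equations stand under the quantifier over \<open>Y\<close>; they can be taken out because
  \<open>Y\<close> is nonempty.\<close>

lemma mixed_solution_iff:
  "solution fR fS (u, \<phi>, \<zeta>) \<longleftrightarrow> \<zeta> \<in> Y \<and> B u = J \<phi> \<and>
     (\<forall>v. aR u v + b v \<phi> + c (B v) \<zeta> = blinfun_apply fR v) \<and>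
     (\<forall>\<psi>. b u \<psi> + aS \<phi> \<psi> - c (J \<psi>) \<zeta> = blinfun_apply fS \<psi>)"
proof -
  have "(\<forall>\<eta>\<in>Y. c (B u) \<eta> - c (J \<phi>) \<eta> = 0) \<longleftrightarrow> B u = J \<phi>"
    using Y.ip_eqI[of "B u" "J \<phi>"] by auto
  moreover have "Y \<noteq> {}" using Y.W_closed(1) by blast
  ultimately show ?thesis unfolding mixed_solution_def by auto
qed

text \<open>Adding the first equation tested with \<open>v\<close> and the second tested with
  \<open>lift v\<close> cancels the multiplier, because \<open>J (lift v) = B v\<close>.\<close>

lemma solution_primal:
  assumes "solution fR fS (u, \<phi>, \<zeta>)"
  shows "u \<in> V" "lift u = \<phi>"
    and "v \<in> V \<Longrightarrow> a u v = blinfun_apply fR v + blinfun_apply fS (lift v)"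
proof -
  have *: "B u = J \<phi>" and eqs: "\<And>v. aR u v + b v \<phi> + c (B v) \<zeta> = blinfun_apply fR v"
    "\<And>\<psi>. b u \<psi> + aS \<phi> \<psi> - c (J \<psi>) \<zeta> = blinfun_apply fS \<psi>"
    using assms unfolding mixed_solution_iff by auto
  show "u \<in> V" "lift u = \<phi>" using * by (auto simp: mem_V lift_eq)
  then show "a u v = blinfun_apply fR v + blinfun_apply fS (lift v)" if "v \<in> V"
    using eqs(1)[of v] eqs(2)[of "lift v"] that by (simp add: primal_form_def J_lift)
qed

lemma solution_exists: "\<exists>x. solution fR fS x"
proof -
  obtain m where m: "m > 0" "\<And>v. v \<in> V \<Longrightarrow> m * (norm v + norm (lift v)) \<le> ip_norm a v"
    using energy_lower by blast
  define F where "F = norm fR + norm fS"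
  have "\<exists>u\<in>V. \<forall>v\<in>V. a u v = blinfun_apply fR v + blinfun_apply fS (lift v)"
  proof (rule energy.Riesz_representation)
    fix v assume v: "v \<in> V"
    have "\<bar>blinfun_apply fR v + blinfun_apply fS (lift v)\<bar> \<le> norm fR * norm v + norm fS * norm (lift v)"
      using norm_blinfun[of fR v] norm_blinfun[of fS "lift v"] by simp
    also have "\<dots> \<le> F * (norm v + norm (lift v))"
      by (simp add: F_def algebra_simps)
    also have "\<dots> \<le> F * (ip_norm a v / m)"
      using m(1) m(2)[OF v] by (intro mult_left_mono) (auto simp: F_def field_simps)
    finally show "\<bar>blinfun_apply fR v + blinfun_apply fS (lift v)\<bar> \<le> (F / m) * ip_norm a v" by simp
  qed (auto simp: lift_add lift_scale blinfun.add_right blinfun.scaleR_right algebra_simps)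
  then obtain u where u: "u \<in> V"
    and au: "\<And>v. v \<in> V \<Longrightarrow> a u v = blinfun_apply fR v + blinfun_apply fS (lift v)" by blast
  define \<phi> where "\<phi> = lift u"
  \<comment> \<open>The residuals of the first two equations. Their signs are opposite because the
    multiplier enters those equations with opposite signs; the goal is a \<zeta> in \<open>Y\<close>
    with \<open>c (B r + J s) \<zeta> = g (r, s)\<close>.\<close>
  define g where "g p = (blinfun_apply fR (fst p) - aR u (fst p) - b (fst p) \<phi>)
      + (b u (snd p) + aS \<phi> (snd p) - blinfun_apply fS (snd p))" for p
  interpret g: bounded_linear g
    unfolding g_def
    by (intro bounded_linear_add bounded_linear_sub
        bounded_linear_compose[OF blinfun.bounded_linear_right]
        bounded_linear_compose[OF aR.bounded_linear_right]
        bounded_linear_compose[OF aS.bounded_linear_right]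
        bounded_linear_compose[OF b.bounded_linear_right]
        bounded_linear_compose[OF b.bounded_linear_left] bounded_linear_fst bounded_linear_snd)
  \<comment> \<open>Such an \<open>r\<close> lies in \<open>V\<close> with
    \<open>lift r = - s\<close>, so the claim is the primal equation tested with
    \<open>r\<close>.\<close>
  have g_kernel: "g (r, s) = 0" if "B r + J s = 0" for r s
  proof -
    have Br: "B r = J (- s)" using that by (simp add: J.neg eq_neg_iff_add_eq_0)
    then have "r \<in> V" "lift r = - s" by (auto simp: mem_V lift_eq)
    then show ?thesis
      using au[of r] by (simp add: g_def primal_form_def \<phi>_def b.minus_right aS.minus_right blinfun.minus_right)
  qed
  \<comment> \<open>The choice picks an arbitrary decomposition of \<open>y\<close>;
    \<open>g_kernel\<close> makes the value independent of it. Only values on \<open>Y\<close> are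
    used.\<close>
  define l where "l y = g (SOME p. B (fst p) + J (snd p) = y)" for y
  have l_eq: "l (B r + J s) = g (r, s)" for r s
  proof -
    define p where "p = (SOME p. B (fst p) + J (snd p) = B r + J s)"
    have "B (fst p) + J (snd p) = B r + J s"
      unfolding p_def by (rule someI[of _ "(r, s)"]) simp
    then have "g (fst p - r, snd p - s) = 0"
      by (intro g_kernel) (simp add: B.diff J.diff algebra_simps)
    then have "g p - g (r, s) = 0" by (simp flip: g.diff add: minus_prod_def)
    then show ?thesis by (simp add: l_def p_def)
  qed
  have l_lin: "l (y + z) = l y + l z" "l (k *\<^sub>R y) = k * l y" if yz: "y \<in> Y" "z \<in> Y" for k y z
  proof -
    obtain r s r' s' where y: "y = B r + J s" and z: "z = B r' + J s'"
      using yz unfolding Y_space_def by auto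
    have "y + z = B (r + r') + J (s + s')" "k *\<^sub>R y = B (k *\<^sub>R r) + J (k *\<^sub>R s)"
      by (simp_all add: y z B.add J.add B.scaleR J.scaleR algebra_simps)
    then have "l (y + z) = g ((r, s) + (r', s'))" "l (k *\<^sub>R y) = g (k *\<^sub>R (r, s))"
      by (simp_all only: l_eq add_Pair scaleR_Pair)
    then show "l (y + z) = l y + l z" "l (k *\<^sub>R y) = k * l y"
      by (simp_all only: y z l_eq g.add g.scaleR real_scaleR_def)
  qed
  obtain C where C: "C > 0" "\<And>y. y \<in> Y \<Longrightarrow> \<exists>r s. y = B r + J s \<and> norm (r, s) \<le> C * Y.nrm y"
    using stable_decomposition by blast
  obtain G where G: "G > 0" "\<And>p. \<bar>g p\<bar> \<le> norm p * G" using g.pos_bounded by auto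
  have "\<exists>\<zeta>\<in>Y. \<forall>y\<in>Y. c \<zeta> y = l y"
  proof (rule Y.Riesz_representation)
    fix y assume "y \<in> Y"
    \<comment> \<open>By \<open>l_eq\<close> any decomposition computes \<open>l y\<close>, so the
      controlled one may be used in place of the one chosen in \<open>l\<close>.\<close>
    then obtain r s where y: "y = B r + J s" "norm (r, s) \<le> C * Y.nrm y" using C(2) by blast
    have "\<bar>l y\<bar> \<le> norm (r, s) * G" using G(2) by (simp add: y l_eq)
    also have "\<dots> \<le> (C * Y.nrm y) * G" using y(2) G(1) by (intro mult_right_mono) auto
    finally show "\<bar>l y\<bar> \<le> (C * G) * Y.nrm y" by (simp add: ac_simps)
  qed (use l_lin in auto)
  then obtain \<zeta> where \<zeta>: "\<zeta> \<in> Y" "\<And>y. y \<in> Y \<Longrightarrow> c \<zeta> y = l y" by blast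
  have "c (B v) \<zeta> = g (v, 0)" "c (J \<psi>) \<zeta> = g (0, \<psi>)" for v \<psi>
    using \<zeta> l_eq[of v 0] l_eq[of 0 \<psi>] Y.ip_commute[of "B v" \<zeta>] Y.ip_commute[of "J \<psi>" \<zeta>]
    by (simp_all add: B.zero J.zero)
  then have "solution fR fS (u, \<phi>, \<zeta>)"
    unfolding mixed_solution_iff using \<zeta>(1) u
    by (simp add: \<phi>_def J_lift g_def aR.zero_right aS.zero_right b.zero_left b.zero_right blinfun.zero_right)
  then show ?thesis ..
qed

text \<open>Testing the primal equation with \<open>u\<close> bounds \<open>u\<close> and \<phi> by
  coercivity. The multiplier is then bounded by pairing it with itself along a stable
  decomposition.\<close>

lemma solution_upper_bound:
  "\<exists>C>0. \<forall>fR fS u \<phi> \<zeta>. solution fR fS (u, \<phi>, \<zeta>) \<longrightarrow>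
     norm u + norm \<phi> + Y_norm B J \<zeta> \<le> C * (norm fR + norm fS)"
proof -
  obtain m where m: "m > 0" "\<And>v. v \<in> V \<Longrightarrow> m * (norm v + norm (lift v)) \<le> ip_norm a v"
    using energy_lower by blast
  obtain K where K: "K > 0" "\<And>x y. \<bar>aR x y\<bar> \<le> K * norm x * norm y"
    "\<And>x y. \<bar>b x y\<bar> \<le> K * norm x * norm y" "\<And>x y. \<bar>aS x y\<bar> \<le> K * norm x * norm y"
    using forms_bound by blast
  obtain C where C: "C > 0" "\<And>y. y \<in> Y \<Longrightarrow> \<exists>r s. y = B r + J s \<and> norm (r, s) \<le> C * Y.nrm y"
    using stable_decomposition by blast
  obtain k where k: "k > 0" "\<And>y. y \<in> Y \<Longrightarrow> k * Y_norm B J y \<le> Y.nrm y"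
    using c_norm unfolding norm_equiv_on_def by blast
  \<comment> \<open>The first summand bounds \<open>u\<close> and \<phi>; the second bounds \<zeta>,
    where the division by \<open>k\<close> passes from the norm of \<open>c\<close> to
    \<open>Y_norm\<close>.\<close>
  define D where "D = 1 / m\<^sup>2 + C * (1 + 2 * K / m\<^sup>2) / k"
  have "norm u + norm \<phi> + Y_norm B J \<zeta> \<le> D * (norm fR + norm fS)"
    if sol: "solution fR fS (u, \<phi>, \<zeta>)" for fR fS u \<phi> \<zeta>
  proof -
    define E where "E = norm u + norm \<phi>"
    define F where "F = norm fR + norm fS"
    define z where "z = Y.nrm \<zeta>"
    have E0: "E \<ge> 0" and F0: "F \<ge> 0" by (simp_all add: E_def F_def)
    note u = solution_primal[OF sol]
    have "m * E \<le> ip_norm a u" using m(2)[OF u(1)] by (simp add: u(2) E_def)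
    then have "(m * E)\<^sup>2 \<le> (ip_norm a u)\<^sup>2" using m(1) E0 by (intro power_mono) auto
    also have "\<dots> = blinfun_apply fR u + blinfun_apply fS \<phi>"
      using u by (simp add: energy.nrm_sq)
    also have "\<dots> \<le> norm fR * norm u + norm fS * norm \<phi>"
      using norm_blinfun[of fR u] norm_blinfun[of fS \<phi>] by simp
    also have "\<dots> \<le> F * E" by (simp add: F_def E_def algebra_simps)
    finally have "(m\<^sup>2 * E) * E \<le> F * E" by (simp add: power2_eq_square ac_simps)
    then have "m\<^sup>2 * E \<le> F" using E0 F0 by (cases "E = 0") auto
    then have E: "E \<le> F / m\<^sup>2" using m(1) by (simp add: field_simps)
    have \<zeta>: "\<zeta> \<in> Y" and eqs: "\<And>v. aR u v + b v \<phi> + c (B v) \<zeta> = blinfun_apply fR v"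
      "\<And>\<psi>. b u \<psi> + aS \<phi> \<psi> - c (J \<psi>) \<zeta> = blinfun_apply fS \<psi>"
      using sol unfolding mixed_solution_iff by auto
    have z0: "z \<ge> 0" using \<zeta> by (simp add: z_def)
    obtain r s where rs: "\<zeta> = B r + J s" "norm (r, s) \<le> C * z"
      using C(2)[OF \<zeta>] unfolding z_def by blast
    have r: "norm r \<le> C * z" and s: "norm s \<le> C * z"
      using rs(2) norm_fst_le[of r s] norm_snd_le[of s r] by linarith+
    \<comment> \<open>Splitting \<zeta> as \<open>B r + J s\<close> in the first argument only turns
      the square into the multiplier terms of the first equation at \<open>r\<close> and of the
      second at \<open>s\<close>.\<close>
    have "z\<^sup>2 = c (B r) \<zeta> + c (J s) \<zeta>"
      using \<zeta> Y.ip_add_left[of "B r" "J s" \<zeta>] by (simp add: z_def Y.nrm_sq rs(1)[symmetric])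
    also have "\<dots> = blinfun_apply fR r - aR u r - b r \<phi> + (b u s + aS \<phi> s - blinfun_apply fS s)"
      using eqs(1)[of r] eqs(2)[of s] by simp
    also have "\<dots> \<le> norm fR * norm r + K * norm u * norm r + K * norm \<phi> * norm r
        + (K * norm u * norm s + K * norm \<phi> * norm s + norm fS * norm s)"
      using norm_blinfun[of fR r] norm_blinfun[of fS s] K(2)[of u r] K(3)[of r \<phi>] K(3)[of u s] K(4)[of \<phi> s]
      by (simp add: ac_simps)
    also have "\<dots> \<le> norm fR * (C * z) + K * norm u * (C * z) + K * norm \<phi> * (C * z)
        + (K * norm u * (C * z) + K * norm \<phi> * (C * z) + norm fS * (C * z))"
      using r s K(1) by (intro add_mono mult_left_mono) auto
    also have "\<dots> = (C * (F + 2 * K * E)) * z" by (simp add: F_def E_def algebra_simps)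
    finally have "z * z \<le> (C * (F + 2 * K * E)) * z" by (simp add: power2_eq_square)
    then have "z \<le> C * (F + 2 * K * E)" using z0 C(1) K(1) E0 F0 by (cases "z = 0") auto
    also have "\<dots> \<le> C * (F + 2 * K * (F / m\<^sup>2))"
      using C(1) K(1) E by (intro mult_left_mono add_left_mono) auto
    finally have z: "z \<le> C * (1 + 2 * K / m\<^sup>2) * F" by (simp add: algebra_simps)
    have "Y_norm B J \<zeta> \<le> z / k" using k(1) k(2)[OF \<zeta>] by (simp add: z_def field_simps)
    also have "\<dots> \<le> C * (1 + 2 * K / m\<^sup>2) * F / k" using z k(1) by (intro divide_right_mono) auto
    finally show ?thesis using E unfolding D_def E_def[symmetric] F_def[symmetric] by (simp add: distrib_right)
  qed
  moreover have "D > 0" using m(1) C(1) K(1) k(1) unfolding D_def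
    by (intro add_pos_nonneg) (auto intro!: divide_nonneg_nonneg mult_nonneg_nonneg)
  ultimately show ?thesis by blast
qed

text \<open>The first two equations express \<open>fR\<close> and \<open>fS\<close> through the
  solution, so continuity of the forms and of the sum map bounds their operator norms.\<close>

lemma solution_lower_bound:
  "\<exists>C>0. \<forall>fR fS u \<phi> \<zeta>. solution fR fS (u, \<phi>, \<zeta>) \<longrightarrow>
     C * (norm fR + norm fS) \<le> norm u + norm \<phi> + Y_norm B J \<zeta>"
proof -
  obtain K where K: "K > 0" "\<And>x y. \<bar>aR x y\<bar> \<le> K * norm x * norm y"
    "\<And>x y. \<bar>b x y\<bar> \<le> K * norm x * norm y" "\<And>x y. \<bar>aS x y\<bar> \<le> K * norm x * norm y"
    using forms_bound by blast
  obtain L where L: "L > 0" "\<And>r s. Y.nrm (B r + J s) \<le> L * (norm r + norm s)"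
    using sum_bound by blast
  obtain k where k: "k > 0" "\<And>y. y \<in> Y \<Longrightarrow> Y.nrm y \<le> k * Y_norm B J y"
    using c_norm unfolding norm_equiv_on_def by blast
  \<comment> \<open>The factor 2 arises because each functional is bounded separately by the same
    \<open>M\<close>; \<open>L * k\<close> combines the sum map bound with the passage to
    \<open>Y_norm\<close>.\<close>
  define D where "D = 2 * (K + L * k)"
  have D: "D > 0" using K(1) L(1) k(1) by (simp add: D_def add_pos_pos)
  have "1 / D * (norm fR + norm fS) \<le> norm u + norm \<phi> + Y_norm B J \<zeta>"
    if sol: "solution fR fS (u, \<phi>, \<zeta>)" for fR fS u \<phi> \<zeta>
  proof -
    have \<zeta>: "\<zeta> \<in> Y" and eqs: "\<And>v. aR u v + b v \<phi> + c (B v) \<zeta> = blinfun_apply fR v"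
      "\<And>\<psi>. b u \<psi> + aS \<phi> \<psi> - c (J \<psi>) \<zeta> = blinfun_apply fS \<psi>"
      using sol unfolding mixed_solution_iff by auto
    define z where "z = Y.nrm \<zeta>"
    have z: "0 \<le> z" "z \<le> k * Y_norm B J \<zeta>" using k(2)[OF \<zeta>] \<zeta> by (auto simp: z_def)
    define M where "M = K * (norm u + norm \<phi>) + L * z"
    have "0 \<le> M" using K L z by (simp add: M_def)
    have B: "\<bar>c (B v) \<zeta>\<bar> \<le> L * norm v * z" for v
    proof -
      have "\<bar>c (B v) \<zeta>\<bar> \<le> Y.nrm (B v) * z" unfolding z_def using \<zeta> by (intro Y.Cauchy_Schwarz) auto
      also have "\<dots> \<le> L * norm v * z"
        using L(2)[of v 0] z(1) by (intro mult_right_mono) (auto simp: J.zero)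
      finally show ?thesis .
    qed
    have J: "\<bar>c (J \<psi>) \<zeta>\<bar> \<le> L * norm \<psi> * z" for \<psi>
    proof -
      have "\<bar>c (J \<psi>) \<zeta>\<bar> \<le> Y.nrm (J \<psi>) * z" unfolding z_def using \<zeta> by (intro Y.Cauchy_Schwarz) auto
      also have "\<dots> \<le> L * norm \<psi> * z"
        using L(2)[of 0 \<psi>] z(1) by (intro mult_right_mono) (auto simp: B.zero)
      finally show ?thesis .
    qed
    have fR: "norm fR \<le> M"
    proof (rule norm_blinfun_bound[OF \<open>0 \<le> M\<close>])
      fix v
      show "norm (blinfun_apply fR v) \<le> M * norm v"
        using eqs(1)[of v] K(2)[of u v] K(3)[of v \<phi>] B[of v] by (simp add: M_def algebra_simps)
    qed
    have fS: "norm fS \<le> M"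
    proof (rule norm_blinfun_bound[OF \<open>0 \<le> M\<close>])
      fix \<psi>
      show "norm (blinfun_apply fS \<psi>) \<le> M * norm \<psi>"
        using eqs(2)[of \<psi>] K(3)[of u \<psi>] K(4)[of \<phi> \<psi>] J[of \<psi>] by (simp add: M_def algebra_simps)
    qed
    have M: "M \<le> K * (norm u + norm \<phi>) + L * (k * Y_norm B J \<zeta>)"
      unfolding M_def using L z by (intro add_left_mono mult_left_mono) auto
    have "norm fR + norm fS \<le> 2 * M" using fR fS by simp
    also have "\<dots> \<le> 2 * (K * (norm u + norm \<phi>) + L * (k * Y_norm B J \<zeta>))"
      using M by (intro mult_left_mono) auto
    also have "\<dots> \<le> D * (norm u + norm \<phi> + Y_norm B J \<zeta>)"
    proof -
      \<comment> \<open>Nonnegativity is read off from the comparison with the norm of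
        \<open>c\<close>. The products in the next line are the terms by which the right-hand side,
        once expanded, exceeds the bound on \<open>2 * M\<close>, up to the factor 2.\<close>
      have "0 \<le> Y_norm B J \<zeta>" using z k(1) by (smt (verit) mult_pos_neg)
      then have "0 \<le> K * Y_norm B J \<zeta>" "0 \<le> L * k * (norm u + norm \<phi>)" using K L k by auto
      then show ?thesis by (simp add: D_def algebra_simps)
    qed
    finally show ?thesis using D by (simp add: field_simps)
  qed
  then show ?thesis using D by (intro exI[of _ "1 / D"]) auto
qed

lemma solution_diff:
  assumes "solution fR fS (u, \<phi>, \<zeta>)" "solution fR' fS' (u', \<phi>', \<zeta>')"
  shows "solution (fR - fR') (fS - fS') (u - u', \<phi> - \<phi>', \<zeta> - \<zeta>')"
  using assms unfolding mixed_solution_iff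
  by (simp add: B.diff J.diff Y.ip_diff_right aR.diff_left aS.diff_left b.diff_left b.diff_right
      blinfun.diff_left algebra_simps)

text \<open>The difference of two solutions solves the system with zero data, so the upper bound
  annihilates all three norms. For the multiplier, vanishing of \<open>Y_norm\<close> passes to the
  definite norm of \<open>c\<close>.\<close>

lemma solution_unique:
  assumes "solution fR fS x" "solution fR fS x'"
  shows "x = x'"
proof -
  obtain u \<phi> \<zeta> u' \<phi>' \<zeta>' where x: "x = (u, \<phi>, \<zeta>)" "x' = (u', \<phi>', \<zeta>')"
    by (metis prod_cases3)
  have sol: "solution 0 0 (u - u', \<phi> - \<phi>', \<zeta> - \<zeta>')"
    using solution_diff[OF assms[unfolded x]] by simp
  then have Y: "\<zeta> - \<zeta>' \<in> Y" by (simp add: mixed_solution_iff)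
  have le: "norm (u - u') + norm (\<phi> - \<phi>') + Y_norm B J (\<zeta> - \<zeta>') \<le> 0"
    using solution_upper_bound sol by fastforce
  obtain K where K: "K > 0" "Y.nrm (\<zeta> - \<zeta>') \<le> K * Y_norm B J (\<zeta> - \<zeta>')"
    using c_norm Y unfolding norm_equiv_on_def by blast
  then have "0 \<le> Y_norm B J (\<zeta> - \<zeta>')"
    using Y.nrm_nonneg[OF Y] by (smt (verit) mult_pos_neg)
  then have "norm (u - u') = 0" "norm (\<phi> - \<phi>') = 0" "Y_norm B J (\<zeta> - \<zeta>') = 0"
    using le norm_ge_zero[of "u - u'"] norm_ge_zero[of "\<phi> - \<phi>'"] by linarith+
  moreover from this have "\<zeta> - \<zeta>' = 0" using Y.nrm_pos[OF Y] K(2) by force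
  ultimately show ?thesis by (simp add: x)
qed

end

text \<open>Here \<open>norm fR\<close> and \<open>norm fS\<close> are operator norms, that is, dual
  norms. The last two claims are stated for every solution, and the first makes this the unique one;
  \<open>C1\<close> and \<open>C2\<close> are quantified before the data.\<close>

theorem theorem9:
  fixes B :: "'r::{real_inner,complete_space} \<Rightarrow> 'h::{real_inner,complete_space}"
    and J :: "'s::{real_inner,complete_space} \<Rightarrow> 'h"
    and V :: "'r set" and ipV :: "'r \<Rightarrow> 'r \<Rightarrow> real"
    and c :: "'h \<Rightarrow> 'h \<Rightarrow> real"
    and aR :: "'r \<Rightarrow> 'r \<Rightarrow> real" and aS :: "'s \<Rightarrow> 's \<Rightarrow> real" and b :: "'r \<Rightarrow> 's \<Rightarrow> real"
  assumes triple: "configurable B J"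
    and V: "configurated_by V ipV B J"
    and Y_complete: "complete_in_norm (Y_space B J) (Y_norm B J)"
    and c_inner: "inner_product_on (Y_space B J) c"
    and c_norm: "norm_equiv_on (Y_space B J) (ip_norm c) (Y_norm B J)"
    and aR: "bounded_bilinear aR" "symmetric_form aR" "semidefinite_form aR"
    and aS: "bounded_bilinear aS" "symmetric_form aS" "semidefinite_form aS"
    and b: "bounded_bilinear b"
    and coercive: "coercive_on V (ip_norm ipV) (primal_form B J aR aS b)"
  shows "(\<forall>fR fS. \<exists>!x. mixed_solution B J aR aS b c fR fS x) \<and>
    (\<exists>C1>0. \<exists>C2>0. \<forall>fR fS u \<phi> \<zeta>. mixed_solution B J aR aS b c fR fS (u, \<phi>, \<zeta>) \<longrightarrow>
       C1 * (norm fR + norm fS) \<le> norm u + norm \<phi> + Y_norm B J \<zeta> \<and>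
       norm u + norm \<phi> + Y_norm B J \<zeta> \<le> C2 * (norm fR + norm fS)) \<and>
    (\<forall>fR fS u \<phi> \<zeta>. mixed_solution B J aR aS b c fR fS (u, \<phi>, \<zeta>) \<longrightarrow>
       u \<in> V \<and>
       (\<forall>v\<in>V. primal_form B J aR aS b u v =
          blinfun_apply fR v + blinfun_apply fS (lift_S B J v)))"
proof -
  interpret mixed_problem B J V ipV c aR aS b
    unfolding mixed_problem_def by (intro conjI assms)
  obtain C1 C2 where "C1 > 0" "C2 > 0" and
    "\<And>fR fS u \<phi> \<zeta>. solution fR fS (u, \<phi>, \<zeta>) \<Longrightarrow>
      C1 * (norm fR + norm fS) \<le> norm u + norm \<phi> + Y_norm B J \<zeta>"
    "\<And>fR fS u \<phi> \<zeta>. solution fR fS (u, \<phi>, \<zeta>) \<Longrightarrow>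
      norm u + norm \<phi> + Y_norm B J \<zeta> \<le> C2 * (norm fR + norm fS)"
    using solution_lower_bound solution_upper_bound by metis
  then have "\<exists>C1>0. \<exists>C2>0. \<forall>fR fS u \<phi> \<zeta>. solution fR fS (u, \<phi>, \<zeta>) \<longrightarrow>
       C1 * (norm fR + norm fS) \<le> norm u + norm \<phi> + Y_norm B J \<zeta> \<and>
       norm u + norm \<phi> + Y_norm B J \<zeta> \<le> C2 * (norm fR + norm fS)"
    by blast
  moreover have "\<forall>fR fS. \<exists>!x. solution fR fS x"
    using solution_exists solution_unique by blast
  ultimately show ?thesis
    using solution_primal(1,3) by blast
qed

end
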